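(* Let $\underline a=\{a_n\}_{n=0}^\infty$ be a (strictly) increasing sequence of integers, and put $r_n=2^{-(a_n+1)}\in\mathbb{R}$ and $g_n=a_{n+1}-a_n$. The set $R_{\underline a,2}=\{0\}\cup\{\pm r_n\mid n\in\mathbb{N}\}$ is quasi-convex in $\mathbb{R}$ if and only if the following two conditions hold: (i) $g_n>1$ for all but possibly one index $n\in\mathbb{N}$; (ii) if $g_n=1$ for some $n\in\mathbb{N}$, then $g_{n+1}>2$.
   Context: $\mathbb{N}$ includes $0$. $\mathbb{T}=\mathbb{R}/\mathbb{Z}$ with canonical projection $\pi\colon\mathbb{R}\to\mathbb{T}$. Put $\mathbb{T}_+=\pi([-\frac14,\frac14])$. For an abelian topological group $G$, $\widehat G$ is the group of characters, i.e. continuous homomorphisms $G\to\mathbb{T}$. For $E\subseteq G$ and $A\subseteq\widehat G$ put $E^\triangleright=\{\chi\in\widehat G\mid\chi(E)\subseteq\mathbb{T}_+\}$ and $A^\triangleleft=\{x\in G\mid\chi(x)\in\mathbb{T}_+\text{ for all }\chi\in A\}$. The set $E$ is quasi-convex in $G$ if $E=E^{\triangleright\triangleleft}$; equivalently, for every $x\in G\setminus E$ there is $\chi\in E^\triangleright$ with $\chi(x)\notin\mathbb{T}_+$. Here $G=\mathbb{R}$ with its usual topology. *)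

theory Defs
  imports "HOL-Analysis.Analysis"
begin

quotient_type circle = real / "\<lambda>x y :: real. x - y \<in> \<int>"
proof (rule equivpI)
  show "reflp (\<lambda>x y :: real. x - y \<in> \<int>)"
    by (rule reflpI) simp
  show "symp (\<lambda>x y :: real. x - y \<in> \<int>)"
    by (rule sympI) (metis Ints_minus minus_diff_eq)
  show "transp (\<lambda>x y :: real. x - y \<in> \<int>)"
    by (rule transpI) (metis Ints_add add_diff_eq diff_add_cancel)
qed

lift_definition circle_proj :: "real \<Rightarrow> circle" is "\<lambda>x. x" .

instantiation circle :: ab_group_add
begin

lift_definition zero_circle :: circle is 0 .

lift_definition plus_circle :: "circle \<Rightarrow> circle \<Rightarrow> circle" is "(+)"
  by (metis Ints_add add_diff_add)

lift_definition uminus_circle :: "circle \<Rightarrow> circle" is uminus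
  by (metis Ints_minus minus_diff_minus)

lift_definition minus_circle :: "circle \<Rightarrow> circle \<Rightarrow> circle" is "(-)"
proof -
  fix a b c d :: real
  assume "a - b \<in> \<int>" "c - d \<in> \<int>"
  then have "(a - b) - (c - d) \<in> \<int>" by (rule Ints_diff)
  then show "(a - c) - (b - d) \<in> \<int>" by (simp add: algebra_simps)
qed

instance
  by standard (transfer; simp add: algebra_simps)+

end

(* The quotient topology, i.e. the final topology with respect to circle_proj. *)
instantiation circle :: topological_space
begin

definition open_circle :: "circle set \<Rightarrow> bool"
  where "open_circle U \<longleftrightarrow> open (circle_proj -` U)"

instance
  by standard (auto simp: open_circle_def vimage_Union intro: open_Int open_UN)

end

definition circle_plus :: "circle set"
  where "circle_plus = circle_proj ` {-1/4 .. 1/4}"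

definition characters :: "('a::topological_ab_group_add \<Rightarrow> circle) set"
  where "characters = {\<phi>. (\<forall>x y. \<phi> (x + y) = \<phi> x + \<phi> y) \<and> continuous_on UNIV \<phi>}"

definition polar :: "'a::topological_ab_group_add set \<Rightarrow> ('a \<Rightarrow> circle) set"
  where "polar E = {\<phi> \<in> characters. \<phi> ` E \<subseteq> circle_plus}"

definition inverse_polar :: "('a::topological_ab_group_add \<Rightarrow> circle) set \<Rightarrow> 'a set"
  where "inverse_polar A = {x. \<forall>\<phi>\<in>A. \<phi> x \<in> circle_plus}"

definition quasi_convex :: "'a::topological_ab_group_add set \<Rightarrow> bool"
  where "quasi_convex E \<longleftrightarrow> E = inverse_polar (polar E)"

definition dyadic_pt :: "(nat \<Rightarrow> int) \<Rightarrow> nat \<Rightarrow> real"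
  where "dyadic_pt a n = 2 powi (- (a n + 1))"

definition gap :: "(nat \<Rightarrow> int) \<Rightarrow> nat \<Rightarrow> int"
  where "gap a n = a (Suc n) - a n"

definition dyadic_set :: "(nat \<Rightarrow> int) \<Rightarrow> real set"
  where "dyadic_set a = {0} \<union> {dyadic_pt a n |n. True} \<union> {- dyadic_pt a n |n. True}"

end

theory Submission
  imports Defs
begin

text \<open>
  Necessity is purely algebraic. A gap \<open>1\<close> at \<open>n\<close> forces every \<open>\<phi>\<close> in the polar to satisfy
  \<open>\<phi> (r (n + 1)) \<in> \<pi> [-1/8, 1/8]\<close>. So gaps \<open>1\<close> at \<open>m < n\<close> put \<open>r (m + 1) + r (n + 1)\<close> into the
  bipolar, and a gap \<open>1\<close> at \<open>n\<close> followed by a gap \<open>2\<close> does so for \<open>r (n + 1) + r (n + 2)\<close>.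

  For sufficiency only the characters \<open>t \<mapsto> \<pi> (y * t)\<close> are used. If \<open>r (n + 1) < x < r n\<close>, the
  values \<open>y = 2^i / r n\<close> push \<open>x\<close> above \<open>3/4 * r n\<close>, and \<open>y = (3/4) / r n\<close> then excludes \<open>x\<close>,
  unless one of the gaps next to \<open>n\<close> is \<open>1\<close>. Around an exceptional gap \<open>1\<close> at \<open>m\<close>, write
  \<open>x = (1 + e) * r p\<close> with \<open>p = m + 1\<close>: the values \<open>y = (7/8) / r p\<close> and \<open>(9/8) / r p\<close> make \<open>e\<close>
  small, and if \<open>r (k + 1) < \<bar>e\<bar> * r p \<le> r k\<close>, then \<open>y = (3/4 * B + s) / r p\<close> with \<open>B = r p / r k\<close>
  and \<open>s\<close> equal to \<open>7/8\<close> or \<open>1/8\<close> yields \<open>\<bar>e\<bar> * B \<le> 1/6\<close>, whence doubling gives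
  \<open>\<bar>e\<bar> * r p \<le> r (k + 1)\<close>, a contradiction.
\<close>

section \<open>Characters of the line and membership in \<open>circle_plus\<close>, read off on real
  representatives\<close>

text \<open>The preimage of \<open>circle_plus\<close> under \<open>circle_proj\<close>, so that
  estimates can be made in the reals.\<close>

definition near_int :: "real \<Rightarrow> bool"
  where "near_int z \<longleftrightarrow> (\<exists>k::int. \<bar>z - of_int k\<bar> \<le> 1/4)"

lemma circle_proj_eq_iff: "circle_proj x = circle_proj y \<longleftrightarrow> x - y \<in> \<int>"
  by transfer simp

lemma circle_proj_add: "circle_proj (x + y) = circle_proj x + circle_proj y"
  by transfer simp

lemma circle_proj_mem_circle_plus: "circle_proj z \<in> circle_plus \<longleftrightarrow> near_int z"
proof
  assume "circle_proj z \<in> circle_plus"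
  then obtain t where t: "t \<in> {-1/4..1/4}" "z - t \<in> \<int>"
    by (auto simp: circle_plus_def circle_proj_eq_iff)
  then obtain k where "z - t = of_int k" by (auto elim: Ints_cases)
  then have "\<bar>z - of_int k\<bar> \<le> 1/4" using t(1) unfolding atLeastAtMost_iff by linarith
  then show "near_int z" unfolding near_int_def by blast
next
  assume "near_int z"
  then obtain k :: int where "\<bar>z - of_int k\<bar> \<le> 1/4" unfolding near_int_def by blast
  then have "z - of_int k \<in> {-1/4..1/4}" unfolding atLeastAtMost_iff by linarith
  moreover have "circle_proj z = circle_proj (z - of_int k)"
    by (simp add: circle_proj_eq_iff)
  ultimately show "circle_proj z \<in> circle_plus" unfolding circle_plus_def by blast
qed

lemma continuous_circle_proj: "continuous_on UNIV circle_proj"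
  by (simp add: continuous_on_open_vimage open_circle_def)

lemma circle_proj_mult_character: "(\<lambda>x. circle_proj (y * x)) \<in> characters"
proof -
  have "continuous_on UNIV (\<lambda>x. circle_proj (y * x))"
    by (rule continuous_on_compose2[OF continuous_circle_proj]) (auto intro!: continuous_intros)
  then show ?thesis
    by (simp add: characters_def distrib_left circle_proj_add)
qed

lemma inverse_polar_polar_near_int:
  assumes "x \<in> inverse_polar (polar E)" "\<And>e. e \<in> E \<Longrightarrow> near_int (y * e)"
  shows "near_int (y * x)"
proof -
  have "(\<lambda>x. circle_proj (y * x)) \<in> polar E"
    using assms(2) by (auto simp: polar_def circle_proj_mult_character circle_proj_mem_circle_plus)
  then show ?thesis
    using assms(1) by (auto simp: inverse_polar_def circle_proj_mem_circle_plus)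
qed

lemma subset_inverse_polar_polar: "E \<subseteq> inverse_polar (polar E)"
  by (auto simp: inverse_polar_def polar_def)

lemma near_intI: "\<bar>z - of_int k\<bar> \<le> 1/4 \<Longrightarrow> near_int z"
  unfolding near_int_def by blast

lemma near_int_small: "\<bar>z\<bar> \<le> 1/4 \<Longrightarrow> near_int z"
  by (rule near_intI[of _ 0]) simp

lemma near_int_minus [simp]: "near_int (- z) \<longleftrightarrow> near_int z"
proof -
  have "near_int (- z)" if z: "near_int z" for z
  proof -
    obtain k :: int where "\<bar>z - of_int k\<bar> \<le> 1/4" using z unfolding near_int_def by blast
    then have "\<bar>- z - of_int (- k)\<bar> \<le> 1/4" unfolding of_int_minus by linarith
    then show ?thesis by (rule near_intI)
  qed
  from this[of z] this[of "-z"] show ?thesis by auto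
qed

lemma near_int_add_Ints:
  assumes "d \<in> \<int>" shows "near_int (d + z) \<longleftrightarrow> near_int z"
proof -
  obtain k where k: "d = of_int k" using assms by (auto elim: Ints_cases)
  have "circle_proj (d + z) = circle_proj z" by (simp add: circle_proj_eq_iff k)
  then show ?thesis by (metis circle_proj_mem_circle_plus)
qed

lemma near_int_Ints: "z \<in> \<int> \<Longrightarrow> near_int z"
  using near_int_add_Ints[of z 0] near_int_small[of 0] by simp

text \<open>The interval of radius 1/4 about any other integer misses the open interval of radius
  3/4 about \<open>k\<close>.\<close>

lemma near_int_gap:
  assumes "near_int z" "of_int k - 3/4 < z" "z < of_int k + 3/4"
  shows "\<bar>z - of_int k\<bar> \<le> 1/4"
proof -
  obtain l :: int where l: "\<bar>z - of_int l\<bar> \<le> 1/4" using assms unfolding near_int_def by blast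
  then have "l = k" using assms by linarith
  then show ?thesis using l by simp
qed

text \<open>Each test improves the bound 1/2 on \<open>\<bar>2 ^ i * e\<bar>\<close> to 1/4, which
  leaves room for one more doubling.\<close>

lemma near_int_doubling:
  assumes "\<bar>e\<bar> \<le> 1/2" "\<And>i. i < N \<Longrightarrow> near_int (2 ^ i * e)"
  shows "2 ^ N * \<bar>e\<bar> \<le> 1/2"
  using assms(2)
proof (induction N)
  case 0
  then show ?case using assms(1) by simp
next
  case (Suc N)
  have "2 ^ N * \<bar>e\<bar> \<le> 1/2" using Suc by simp
  then have "\<bar>2 ^ N * e\<bar> \<le> 1/2" by (simp add: abs_mult)
  moreover have "near_int (2 ^ N * e)" using Suc.prems by simp
  ultimately have "\<bar>2 ^ N * e\<bar> \<le> 1/4" using near_int_gap[of "2 ^ N * e" 0] by simp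
  then show ?case by (simp add: abs_mult)
qed

section \<open>Ratios and decay of the points \<open>r n\<close>\<close>

locale dyadic_sequence =
  fixes a :: "nat \<Rightarrow> int"
  assumes strict_mono_a: "strict_mono a"
begin

abbreviation r :: "nat \<Rightarrow> real" where "r \<equiv> dyadic_pt a"

text \<open>For \<open>m \<le> n\<close> this is the binary logarithm of \<open>r m / r n\<close>;
  as a natural number it turns ratios into ordinary powers of 2.\<close>

definition dist_exp :: "nat \<Rightarrow> nat \<Rightarrow> nat" where "dist_exp m n = nat (a n - a m)"

lemma a_less: "m < n \<Longrightarrow> a m < a n"
  and a_le: "m \<le> n \<Longrightarrow> a m \<le> a n"
  using strict_mono_a by (auto simp: strict_mono_less strict_mono_less_eq)

lemma r_pos [simp]: "r n > 0"
  by (simp add: dyadic_pt_def)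

lemma r_nonzero [simp]: "r n \<noteq> 0"
  using r_pos[of n] by linarith

lemma r_ratio:
  assumes "m \<le> n" shows "r m = 2 ^ dist_exp m n * r n"
proof -
  have "(2::real) ^ dist_exp m n = 2 powi (a n - a m)"
    using a_le[OF assms] by (simp add: dist_exp_def power_int_def)
  then show ?thesis
    unfolding dyadic_pt_def by (simp flip: power_int_add)
qed

lemma dist_exp_Suc: "dist_exp n (Suc n) = nat (gap a n)"
  by (simp add: dist_exp_def gap_def)

lemma dist_exp_add: "l \<le> m \<Longrightarrow> m \<le> n \<Longrightarrow> dist_exp l n = dist_exp l m + dist_exp m n"
  using a_le[of l m] a_le[of m n] by (simp add: dist_exp_def)

lemma dist_exp_ge_gap: "m < n \<Longrightarrow> dist_exp m n \<ge> nat (gap a m)"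
  using dist_exp_add[of m "Suc m" n] dist_exp_Suc[of m] by simp

lemma dist_exp_ge_gap': "m < n \<Longrightarrow> dist_exp m n \<ge> nat (gap a (n - 1))"
  using dist_exp_add[of m "n - 1" n] dist_exp_Suc[of "n - 1"] by simp

lemma r_strict_antimono: "m < n \<Longrightarrow> r n < r m"
  using r_ratio[of m n] a_less[of m n]
  by (simp add: dist_exp_def one_less_power)

lemma r_antimono: "m \<le> n \<Longrightarrow> r n \<le> r m"
  using r_strict_antimono[of m n] by (cases "m = n") auto

lemma gap_ge_1: "gap a n \<ge> 1"
  using a_less[of n "Suc n"] by (simp add: gap_def)

lemma two_r_le:
  assumes "m < n" shows "2 * r n \<le> r m"
proof -
  have "dist_exp m n \<ge> 1" using a_less[OF assms] by (simp add: dist_exp_def)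
  then have "(2::real) ^ 1 \<le> 2 ^ dist_exp m n" by (intro power_increasing) auto
  then show ?thesis using r_ratio[of m n] assms by simp
qed

lemma r_bracket:
  assumes "0 < z" "z \<le> r n"
  obtains k where "n \<le> k" "r (Suc k) < z" "z \<le> r k"
proof -
  have ex: "\<exists>N. r N < z"
  proof -
    \<comment> \<open>Every index at least halves \<open>r\<close>, so the points decay
      geometrically and fall below \<open>z\<close>.\<close>
    have bound: "2 ^ k * r k \<le> r 0" for k
    proof (induction k)
      case (Suc k)
      have "2 * r (Suc k) \<le> r k" by (rule two_r_le) simp
      then have "2 ^ k * (2 * r (Suc k)) \<le> 2 ^ k * r k" by (intro mult_left_mono) auto
      then have "2 ^ k * (2 * r (Suc k)) \<le> r 0" using Suc by linarith
      then show ?case by (simp add: mult_ac)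
    qed simp
    obtain N where "r 0 / z < 2 ^ N" using real_arch_pow[of 2 "r 0 / z"] by auto
    then have "r 0 < 2 ^ N * z" using assms by (simp add: field_simps)
    then have "2 ^ N * r N < 2 ^ N * z" using bound[of N] by linarith
    then show ?thesis by auto
  qed
  define N where "N = (LEAST N. r N < z)"
  have N: "r N < z" unfolding N_def using ex by (metis LeastI)
  have "n < N" using r_antimono[of N n] N assms by (metis leD le_less_linear order.trans)
  then obtain k where k: "N = Suc k" "n \<le> k" by (cases N) auto
  then have "\<not> r k < z" using not_less_Least[of k "\<lambda>N. r N < z"] by (simp add: N_def)
  then show ?thesis using that k N by auto
qed

section \<open>Tests by linear characters, and intervals away from a gap of 1\<close>

text \<open>An upper bound for the bipolar of \<open>dyadic_set a\<close>. Testing on the points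
  \<open>r n\<close> is enough, because \<open>near_int\<close> is even and holds at 0.\<close>

definition bihull :: "real \<Rightarrow> bool"
  where "bihull x \<longleftrightarrow> (\<forall>y. (\<forall>n. near_int (y * r n)) \<longrightarrow> near_int (y * x))"

lemma bihull_minus [simp]: "bihull (- x) \<longleftrightarrow> bihull x"
  by (auto simp: bihull_def)

text \<open>This is the test \<open>y = c / r n\<close>: it multiplies \<open>c\<close> by a power
  of 2 at points up to \<open>n\<close> and divides it by one at later points.\<close>

lemma bihull_scaled:
  assumes "bihull x"
    and "\<And>l. l \<le> n \<Longrightarrow> near_int (c * 2 ^ dist_exp l n)"
    and "\<And>l. n < l \<Longrightarrow> near_int (c / 2 ^ dist_exp n l)"
  shows "near_int (c * (x / r n))"
proof -
  have "near_int (c / r n * r l)" for l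
  proof (cases "l \<le> n")
    case True
    then show ?thesis using assms(2)[of l] by (simp add: r_ratio[of l n])
  next
    case False
    then have "c / r n * r l = c / 2 ^ dist_exp n l" using r_ratio[of n l] by (simp add: field_simps)
    then show ?thesis using assms(3)[of l] False by simp
  qed
  then show ?thesis using assms(1) unfolding bihull_def by (metis times_divide_eq_left times_divide_eq_right)
qed

lemma pow_dist_exp_ge:
  assumes "nat (gap a n) \<ge> N" "n < l" shows "(2::real) ^ N \<le> 2 ^ dist_exp n l"
  using dist_exp_ge_gap[OF assms(2)] assms(1) by (intro power_increasing) auto

text \<open>For \<open>l < n\<close> the exponent contains the whole gap just before
  \<open>n\<close>, so denominators cleared by \<open>2 ^ N\<close> are cleared here too.\<close>

lemma pow_dist_exp_Ints:
  fixes c :: real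
  assumes "nat (gap a (n - 1)) \<ge> N" "l < n" "c * 2 ^ N \<in> \<int>"
  shows "c * 2 ^ dist_exp l n \<in> \<int>"
proof -
  obtain d where d: "dist_exp l n = N + d"
    using dist_exp_ge_gap'[OF assms(2)] assms(1) by (metis le_trans le_Suc_ex)
  have "c * 2 ^ N * 2 ^ d \<in> \<int>" by (intro Ints_mult[OF assms(3)]) simp
  then show ?thesis by (simp add: d power_add mult.assoc)
qed

lemma near_int_small_div:
  assumes "0 \<le> c" "c \<le> D / 4" "0 < D" shows "near_int (c / D)"
  using assms by (intro near_int_small) (simp add: abs_le_iff field_simps)

text \<open>The bound on \<open>i\<close> means \<open>i + 2 \<le> gap a n\<close>: points up to
  \<open>n\<close> go to integers, later ones to at most 1/4. For a gap of 1 it is vacuous.\<close>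

lemma bihull_power:
  assumes "bihull x" "i < nat (gap a n - 1)"
  shows "near_int (2 ^ i * (x / r n))"
proof (rule bihull_scaled[OF assms(1)])
  fix l show "near_int (2 ^ i * 2 ^ dist_exp l n)" by (intro near_int_Ints Ints_mult) auto
next
  fix l assume l: "n < l"
  have "(2::real) ^ (i + 2) \<le> 2 ^ dist_exp n l"
    using assms l by (intro pow_dist_exp_ge) auto
  then show "near_int (2 ^ i / 2 ^ dist_exp n l)"
    by (intro near_int_small_div) auto
qed

text \<open>Doubling \<open>gap a n - 1\<close> times reaches 1/2 at most, and \<open>r n\<close> is
  \<open>2 ^ gap\<close> times \<open>r (Suc n)\<close>.\<close>

lemma doubling_le_r_Suc:
  assumes "\<bar>e\<bar> \<le> 1/2" "\<And>i. i < nat (gap a n - 1) \<Longrightarrow> near_int (2 ^ i * e)"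
  shows "\<bar>e\<bar> * r n \<le> r (Suc n)"
proof -
  have "2 ^ nat (gap a n - 1) * \<bar>e\<bar> \<le> 1/2" by (rule near_int_doubling) (use assms in auto)
  moreover have "dist_exp n (Suc n) = Suc (nat (gap a n - 1))" using gap_ge_1[of n] by (simp add: dist_exp_Suc)
  ultimately have "\<bar>e\<bar> * 2 ^ dist_exp n (Suc n) \<le> 1" by (simp add: mult_ac)
  then have "\<bar>e\<bar> * 2 ^ dist_exp n (Suc n) * r (Suc n) \<le> 1 * r (Suc n)"
    by (intro mult_right_mono) (auto intro: less_imp_le)
  then show ?thesis by (simp add: r_ratio[of n "Suc n"])
qed

text \<open>Every slope from 0 to \<open>1 / (4 * r 0)\<close> is an admissible test. The largest
  excludes \<open>x\<close> below \<open>2 * r 0\<close>; beyond that, \<open>1 / (2 * x)\<close>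
  sends \<open>x\<close> to 1/2.\<close>

lemma bihull_le_r0:
  assumes "bihull x" shows "x \<le> r 0"
proof (rule ccontr)
  assume "\<not> x \<le> r 0"
  then have x: "x > r 0" by simp
  have x0: "x > 0" using x r_pos[of 0] by linarith
  have small: "near_int (y * x)" if "0 \<le> y" "y \<le> 1 / (4 * r 0)" for y
  proof -
    have "near_int (y * r n)" for n
    proof (rule near_int_small)
      have "y * r n \<le> 1 / (4 * r 0) * r 0"
        using that r_antimono[of 0 n] by (intro mult_mono) (auto intro: less_imp_le)
      then show "\<bar>y * r n\<bar> \<le> 1/4" using that less_imp_le[OF r_pos[of n]] by (simp add: abs_mult)
    qed
    then show ?thesis using assms by (simp add: bihull_def)
  qed
  show False
  proof (cases "x < 2 * r 0")
    case True
    have "near_int (1 / (4 * r 0) * x)" by (rule small) (simp_all add: less_imp_le)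
    then have "\<bar>1 / (4 * r 0) * x - of_int 0\<bar> \<le> 1/4"
      using True x x0 by (intro near_int_gap) (simp_all add: field_simps)
    then have "1 / (4 * r 0) * x \<le> 1/4" by linarith
    then show False using x by (simp add: field_simps)
  next
    case False
    have "near_int (1 / (2 * x) * x)"
      using False x0 by (intro small) (simp_all add: field_simps)
    then have "near_int (1/2)" using x0 by simp
    then show False using near_int_gap[of "1/2" 0] by simp
  qed
qed

lemma bihull_regular:
  assumes "bihull x" "r (Suc n) < x" "x \<le> r n"
    and "gap a n > 1" "n > 0 \<Longrightarrow> gap a (n - 1) > 1"
  shows "x = r n"
proof (rule ccontr)
  assume "x \<noteq> r n"
  define w where "w = x / r n"
  have xw: "x = w * r n" by (simp add: w_def)
  have "0 < x" using assms(2) r_pos[of "Suc n"] by linarith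
  then have w: "0 < w" "w < 1" using assms(3) \<open>x \<noteq> r n\<close> by (auto simp: w_def)
  have near: "near_int (2 ^ i * w)" if "i < nat (gap a n - 1)" for i
    unfolding w_def by (rule bihull_power[OF assms(1) that])
  have "near_int w" using near[of 0] assms(4) by simp
  show False
  proof (cases "w < 3/4")
    case True
    then have "\<bar>w\<bar> \<le> 1/4" using near_int_gap[OF \<open>near_int w\<close>, of 0] w by simp
    then have "\<bar>w\<bar> * r n \<le> r (Suc n)" using near by (intro doubling_le_r_Suc) auto
    then show False using assms(2) w xw by simp
  next
    case False
    \<comment> \<open>The factor 3/4 gives integers before \<open>n\<close>, 3/4 itself at
      \<open>n\<close>, and at most 3/16 after \<open>n\<close>. But for
      \<open>3/4 \<le> w < 1\<close> the value \<open>3/4 * w\<close> is more than 1/4 away from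
      every integer.\<close>
    have "near_int (3/4 * w)" unfolding w_def
    proof (rule bihull_scaled[OF assms(1)])
      fix l assume l: "l \<le> n"
      show "near_int (3/4 * 2 ^ dist_exp l n)"
      proof (cases "l = n")
        case True
        then show ?thesis by (intro near_intI[of _ 1]) (simp add: dist_exp_def)
      next
        case False
        then show ?thesis using assms(5) l by (intro near_int_Ints pow_dist_exp_Ints[of 2]) auto
      qed
    next
      fix l assume "n < l"
      then have "(2::real)^2 \<le> 2 ^ dist_exp n l" using assms(4) by (intro pow_dist_exp_ge) auto
      then show "near_int (3/4 / 2 ^ dist_exp n l)"
        by (intro near_int_small_div) auto
    qed
    then show False using near_int_gap[of "3/4*w" 1] w False by simp
  qed
qed

section \<open>Intervals around the exceptional gap of 1\<close>

text \<open>Relative to \<open>r (Suc m)\<close>, the point \<open>r m\<close> has ratio 2 and all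
  earlier points have ratios divisible by 8, since a gap of at least 2 precedes the gap 1. Hence the
  conditions on \<open>c\<close>, \<open>2 * c\<close> and \<open>8 * c\<close>.\<close>

lemma bihull_exceptional_scaled:
  assumes "bihull x" "gap a m = 1" "m > 0 \<Longrightarrow> gap a (m - 1) > 1"
    and "near_int c" "near_int (2 * c)" "8 * c \<in> \<int>"
    and "\<And>l. Suc m < l \<Longrightarrow> near_int (c / 2 ^ dist_exp (Suc m) l)"
  shows "near_int (c * (x / r (Suc m)))"
proof (rule bihull_scaled[OF assms(1)])
  fix l assume l: "l \<le> Suc m"
  consider "l = Suc m" | "l = m" | "l < m" using l by linarith
  then show "near_int (c * 2 ^ dist_exp l (Suc m))"
  proof cases
    case 1
    then show ?thesis using assms by (simp add: dist_exp_def)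
  next
    case 2
    then show ?thesis using assms by (simp add: dist_exp_Suc mult.commute)
  next
    case 3
    have "(2 * c) * 2 ^ dist_exp l m \<in> \<int>"
      using 3 assms by (intro pow_dist_exp_Ints[of 2]) (auto simp: mult.commute)
    moreover have "dist_exp l (Suc m) = Suc (dist_exp l m)"
      using dist_exp_add[of l m "Suc m"] 3 assms(2) by (simp add: dist_exp_Suc)
    ultimately show ?thesis by (intro near_int_Ints) (simp add: mult_ac)
  qed
qed (use assms in auto)

text \<open>Doubling at scale \<open>r k\<close> can start once
  \<open>\<bar>B * e\<bar> \<le> 1/2\<close>, while the choice of \<open>k\<close> gives only the
  bound 1. The tests in \<open>main\<close> supply the missing improvement.\<close>

lemma bihull_near_exceptional:
  assumes x: "bihull x" and m: "gap a m = 1" "gap a (Suc m) > 2"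
    and regular: "\<And>n. n \<noteq> m \<Longrightarrow> gap a n > 1"
    and xe: "x = (1 + e) * r (Suc m)" and e: "\<bar>e\<bar> \<le> 1/2"
  shows "e = 0"
proof (rule ccontr)
  assume "e \<noteq> 0"
  define p where "p = Suc m"
  have pow: "near_int (2 ^ i * (2 ^ dist_exp p k * e))" if "p \<le> k" "i < nat (gap a k - 1)" for i k
  proof -
    have "x / r k = 2 ^ dist_exp p k + 2 ^ dist_exp p k * e"
      using xe r_ratio[OF that(1)] by (simp add: p_def field_simps)
    then have "near_int (2 ^ i * 2 ^ dist_exp p k + 2 ^ i * (2 ^ dist_exp p k * e))"
      using bihull_power[OF x that(2)] by (simp add: distrib_left)
    then show ?thesis by (subst (asm) near_int_add_Ints) auto
  qed
  have "\<bar>e\<bar> * r p \<le> r (Suc p)"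
    using pow[of p] e by (intro doubling_le_r_Suc) (auto simp: dist_exp_def)
  moreover have "0 < \<bar>e\<bar> * r p" using \<open>e \<noteq> 0\<close> by simp
  ultimately obtain k where k: "Suc p \<le> k" "r (Suc k) < \<bar>e\<bar> * r p" "\<bar>e\<bar> * r p \<le> r k"
    by (metis r_bracket)
  define d B where "d = dist_exp p k" and "B = (2::real) ^ d"
  have rpk: "r p = B * r k" using r_ratio[of p k] k by (simp add: B_def d_def)
  have d3: "d \<ge> 3" unfolding d_def using dist_exp_ge_gap[of p k] k m(2) by (simp add: p_def)
  have "(2::real)^3 \<le> B" unfolding B_def using d3 by (intro power_increasing) auto
  then have B8: "B \<ge> 8" by simp
  have q_eq: "3 * B / 4 = 2 * (3 * 2 ^ (d - 3))"
  proof -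
    have "(2::real) ^ d = 2 ^ 3 * 2 ^ (d - 3)" using d3
      by (metis le_add_diff_inverse power_add)
    then show ?thesis by (simp add: B_def)
  qed
  have qZ: "3 * B / 4 \<in> \<int>" unfolding q_eq by (intro Ints_mult) auto
  \<comment> \<open>The integer \<open>3 * B / 4\<close> magnifies \<open>e\<close> and disappears
    modulo 1 elsewhere in the value at \<open>x\<close>; \<open>s\<close> then places that value
    near the edge of the admissible zone.\<close>
  have main: "near_int (s + (3 * B / 4 + s) * e)"
    if s: "0 \<le> s" "s \<le> 1" "near_int s" "near_int (2 * s)" "8 * s \<in> \<int>" for s
  proof -
    define c where "c = 3 * B / 4 + s"
    have "near_int (c * (x / r (Suc m)))"
    proof (rule bihull_exceptional_scaled[OF x m(1)])
      show "gap a (m - 1) > 1" if "m > 0" using regular[of "m - 1"] that by simp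
      show "near_int c" unfolding c_def near_int_add_Ints[OF qZ] by (rule s)
      have "near_int (2 * (3 * B / 4) + 2 * s)"
        by (subst near_int_add_Ints) (intro Ints_mult[of 2] Ints_numeral qZ s)+
      then show "near_int (2 * c)" by (simp add: c_def distrib_left)
      have "8 * (3 * B / 4) + 8 * s \<in> \<int>"
        by (intro Ints_add Ints_mult[of 8] qZ s) auto
      then show "8 * c \<in> \<int>" by (simp add: c_def distrib_left)
    next
      fix l assume "Suc m < l"
      then have l: "p < l" by (simp add: p_def)
      have D8: "(2::real) ^ 3 \<le> 2 ^ dist_exp p l"
        using l m(2) by (intro pow_dist_exp_ge) (auto simp: p_def)
      \<comment> \<open>Points before \<open>r k\<close> see an integer plus at most 1/8,
        \<open>r k\<close> sees a value in [3/4, 1], and later points see at most 1/4.\<close>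
      consider "l < k" | "l = k" | "k < l" by linarith
      then have "near_int (c / 2 ^ dist_exp p l)"
      proof cases
        case 1
        have "dist_exp l k \<ge> 2" using dist_exp_ge_gap[OF 1] regular[of l] l by (simp add: p_def)
        then obtain j where "dist_exp l k = 2 + j" using le_Suc_ex by blast
        then have "d = dist_exp p l + 2 + j" unfolding d_def using dist_exp_add[of p l k] 1 l by simp
        then have "c / 2 ^ dist_exp p l = 3 * 2 ^ j + s / 2 ^ dist_exp p l"
          by (simp add: c_def B_def power_add field_simps)
        moreover have "near_int (s / 2 ^ dist_exp p l)"
          using s D8 by (intro near_int_small_div) auto
        ultimately show ?thesis
          using near_int_add_Ints[of "3 * 2 ^ j"] by (simp add: Ints_mult)
      next
        case 2
        have "c / B \<ge> 3/4" "c / B \<le> 1" using s B8 by (auto simp: c_def field_simps)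
        then show ?thesis using 2 by (intro near_intI[of _ 1]) (simp add: B_def d_def abs_le_iff)
      next
        case 3
        have "(2::real)^2 \<le> 2 ^ dist_exp k l"
          using regular[of k] k by (intro pow_dist_exp_ge 3) (simp add: p_def)
        then have "4 * B \<le> 2 ^ dist_exp k l * B" using B8 by (intro mult_right_mono) auto
        then have "4 * B \<le> 2 ^ dist_exp p l"
          using dist_exp_add[of p k l] k 3 by (simp add: B_def d_def power_add mult.commute)
        then show ?thesis using s B8 by (intro near_int_small_div) (auto simp: c_def)
      qed
      then show "near_int (c / 2 ^ dist_exp (Suc m) l)" by (simp add: p_def)
    qed
    moreover have "x / r (Suc m) = 1 + e" by (simp add: xe)
    then have "c * (x / r (Suc m)) = 3 * B / 4 + (s + c * e)"
      by (simp add: c_def algebra_simps)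
    ultimately show ?thesis by (simp add: near_int_add_Ints[OF qZ] c_def)
  qed
  define t v where "t = \<bar>e\<bar>" and "v = B * t"
  have t0: "0 < t" using \<open>e \<noteq> 0\<close> by (simp add: t_def)
  have v1: "v \<le> 1"
    using k(3) by (simp add: rpk t_def v_def mult.commute)
  have v8: "8 * t \<le> v" using B8 t0 by (simp add: v_def)
  have near1: "near_int (1/8 + (3 * B / 4 + 1/8) * e)"
    by (rule main) (auto intro: near_int_small)
  have near7: "near_int (7/8 + (3 * B / 4 + 7/8) * e)"
    by (rule main) (auto intro: near_intI[of _ 1] near_intI[of _ 2])
  \<comment> \<open>The shift 7/8 (for \<open>e > 0\<close>) or 1/8 (for \<open>e < 0\<close>) first
    gives \<open>v \<le> 1/2\<close>. This keeps the other value less than 3/4 from its integer, so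
    \<open>near_int_gap\<close> applies to it as well.\<close>
  have "v \<le> 1/6"
  proof (cases "e > 0")
    case True
    then have et: "e = t" by (simp add: t_def)
    have n1: "near_int (1/8 + 3/4 * v + 1/8 * t)" and n7: "near_int (7/8 + 3/4 * v + 7/8 * t)"
      using near1 near7 by (simp_all add: et v_def algebra_simps)
    have "v \<le> 1/2" using near_int_gap[OF n7, of 1] v1 v8 t0 unfolding of_int_0 of_int_1 by linarith
    then show ?thesis using near_int_gap[OF n1, of 0] v8 t0 unfolding of_int_0 of_int_1 by linarith
  next
    case False
    then have et: "e = - t" by (simp add: t_def)
    have n1: "near_int (1/8 - 3/4 * v - 1/8 * t)" and n7: "near_int (7/8 - 3/4 * v - 7/8 * t)"
      using near1 near7 by (simp_all add: et v_def algebra_simps)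
    have "v \<le> 1/2" using near_int_gap[OF n1, of 0] v1 v8 t0 unfolding of_int_0 of_int_1 by linarith
    then show ?thesis using near_int_gap[OF n7, of 1] v8 t0 unfolding of_int_0 of_int_1 by linarith
  qed
  then have "\<bar>B * e\<bar> * r k \<le> r (Suc k)"
    using pow[of k] k B8 by (intro doubling_le_r_Suc) (auto simp: v_def t_def abs_mult B_def d_def)
  then show False using k(2) B8 by (simp add: rpk abs_mult mult_ac)
qed

lemma bihull_exceptional:
  assumes x: "bihull x" and m: "gap a m = 1" "gap a (Suc m) > 2"
    and regular: "\<And>n. n \<noteq> m \<Longrightarrow> gap a n > 1"
    and n: "n = m \<or> n = Suc m" "r (Suc n) < x" "x \<le> r n"
  shows "x = r m \<or> x = r (Suc m)"
proof (rule ccontr)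
  assume neq: "\<not> (x = r m \<or> x = r (Suc m))"
  define p where "p = Suc m"
  define w where "w = x / r p"
  have xw: "x = w * r p" by (simp add: w_def)
  have w0: "w > 0" using n(2) less_trans[OF r_pos[of "Suc n"]] by (simp add: w_def)
  have rm: "r m = 2 * r p" using r_ratio[of m p] m(1) by (simp add: p_def dist_exp_Suc)
  \<comment> \<open>Both constants lie within 1/4 of 1, their doubles within 1/4 of 2, and both are
    multiples of 1/8.\<close>
  have eighths: "near_int (c * w)" if "c = 7/8 \<or> c = 9/8" for c
  proof -
    have "near_int (c * (x / r (Suc m)))"
    proof (rule bihull_exceptional_scaled[OF x m(1)])
      show "gap a (m - 1) > 1" if "m > 0" using regular[of "m - 1"] that by simp
      show "near_int c" "near_int (2 * c)"
        using that by (auto intro: near_intI[of _ 1] near_intI[of _ 2])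
      have "8 * c = 7 \<or> 8 * c = 9" using that by auto
      then show "8 * c \<in> \<int>" by (metis Ints_numeral)
      fix l assume "Suc m < l"
      then have "(2::real) ^ 3 \<le> 2 ^ dist_exp (Suc m) l"
        using m(2) by (intro pow_dist_exp_ge) auto
      then show "near_int (c / 2 ^ dist_exp (Suc m) l)"
        using that by (intro near_int_small_div) auto
    qed
    then show ?thesis by (simp add: w_def p_def)
  qed
  have near7: "near_int (7/8 * w)" and near9: "near_int (9/8 * w)" by (rule eighths; simp)+
  have "\<bar>w - 1\<bar> \<le> 1/2"
  proof (cases "n = m")
    case True
    \<comment> \<open>At \<open>w = 2\<close>, that is \<open>x = r m\<close>, the test value is
      7/4, which is near 2; strictly below that only the integer 1 is left.\<close>
    have "1 < w" "w < 2" using n True neq rm by (auto simp: w_def p_def pos_divide_less_eq)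
    then have "\<bar>7/8 * w - of_int 1\<bar> \<le> 1/4" by (intro near_int_gap near7) auto
    then have "w \<le> 10/7" by linarith
    then show ?thesis using \<open>1 < w\<close> by simp
  next
    case False
    then have "n = p" using n(1) by (simp add: p_def)
    have "w < 1" using n neq \<open>n = p\<close> by (auto simp: w_def p_def)
    have near: "near_int (2 ^ i * w)" if "i < nat (gap a p - 1)" for i
      unfolding w_def by (rule bihull_power[OF x that])
    have "near_int w" using near[of 0] m(2) by (simp add: p_def)
    have "w \<ge> 1/2"
    proof (rule ccontr)
      assume "\<not> w \<ge> 1/2"
      then have "\<bar>w\<bar> * r p \<le> r (Suc p)" using near w0 by (intro doubling_le_r_Suc) auto
      then show False using n(2) w0 xw \<open>n = p\<close> by simp
    qed
    then show ?thesis using \<open>w < 1\<close> by simp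
  qed
  then have "w - 1 = 0"
    by (intro bihull_near_exceptional[OF x m regular]) (auto simp: xw p_def)
  then show False using neq xw by (simp add: p_def)
qed

text \<open>Only \<open>m\<close> may carry a gap of 1. As \<open>bihull_regular\<close> looks at
  the gap at \<open>n\<close> and the one before it, the intervals left over are those at
  \<open>m\<close> and \<open>Suc m\<close>.\<close>

lemma bihull_pos_imp_r:
  assumes "bihull x" "x > 0"
    and regular: "\<And>n. n \<noteq> m \<Longrightarrow> gap a n > 1"
    and exceptional: "gap a m = 1 \<Longrightarrow> gap a (Suc m) > 2"
  shows "x \<in> range r"
proof -
  obtain n where n: "r (Suc n) < x" "x \<le> r n"
    using r_bracket[OF assms(2) bihull_le_r0[OF assms(1)]] by blast
  show ?thesis
  proof (cases "gap a m = 1 \<and> (n = m \<or> n = Suc m)")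
    case True
    then show ?thesis using bihull_exceptional[OF assms(1) _ exceptional regular] n by blast
  next
    case False
    have "gap a k > 1" if "k \<noteq> m \<or> gap a m \<noteq> 1" for k
      using that regular gap_ge_1[of m] by (cases "k = m") auto
    then have "x = r n" using False n assms(1) by (intro bihull_regular) force+
    then show ?thesis by blast
  qed
qed

section \<open>Necessity: sums of two points that enter the bipolar\<close>

text \<open>The sum lies strictly between \<open>r i\<close> and \<open>2 * r i\<close>, whereas
  points before index \<open>i\<close> are at least \<open>2 * r i\<close>.\<close>

lemma r_add_r_notin:
  assumes "i < j" shows "r i + r j \<notin> dyadic_set a"
proof
  assume "r i + r j \<in> dyadic_set a"
  then consider "r i + r j = 0" | n where "r i + r j = r n" | n where "r i + r j = - r n"
    by (auto simp: dyadic_set_def)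
  then show False
  proof cases
    case 2
    show False
    proof (cases "n < i")
      case True
      then show False using two_r_le[OF True] r_strict_antimono[OF assms] 2 by simp
    next
      case False
      then show False using r_antimono[of i n] 2 r_pos[of j] by simp
    qed
  qed (use r_pos[of i] r_pos[of j] in \<open>auto simp: add_eq_0_iff\<close>, metis add_pos_pos less_asym neg_less_0_iff_less r_pos)
qed

end

text \<open>As \<open>r n\<close> is twice \<open>r (Suc n)\<close>, a representative
  \<open>t\<close> in [-1/4, 1/4] has \<open>2 * t\<close> in [-1/2, 1/2] and near an integer, which
  must be 0.\<close>

lemma character_gap_1:
  assumes "strict_mono a" "\<phi> \<in> polar (dyadic_set a)" "gap a n = 1"
  obtains t where "\<phi> (dyadic_pt a (Suc n)) = circle_proj t" "\<bar>t\<bar> \<le> 1/8"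
proof -
  interpret dyadic_sequence a by standard (rule assms)
  have add: "\<phi> (x + y) = \<phi> x + \<phi> y" for x y
    using assms(2) by (auto simp: polar_def characters_def)
  have mem: "\<phi> (r k) \<in> circle_plus" for k
    using assms(2) by (auto simp: polar_def dyadic_set_def)
  obtain t where t: "\<phi> (r (Suc n)) = circle_proj t" "t \<in> {-1/4..1/4}"
    using mem[of "Suc n"] by (auto simp: circle_plus_def)
  have "r n = r (Suc n) + r (Suc n)"
    using r_ratio[of n "Suc n"] assms(3) by (simp add: dist_exp_Suc)
  then have "\<phi> (r n) = circle_proj (t + t)"
    by (simp only: add t circle_proj_add)
  then have "near_int (t + t)" using mem[of n] by (simp add: circle_proj_mem_circle_plus)
  then have "\<bar>t + t - of_int 0\<bar> \<le> 1/4" using t(2) by (intro near_int_gap) auto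
  then have "\<bar>t\<bar> \<le> 1/8" by (simp add: abs_le_iff)
  then show ?thesis using that t by blast
qed

lemma quasi_convex_dyadic_imp_unique_gap_1:
  assumes a: "strict_mono a" and qc: "quasi_convex (dyadic_set a)"
    and gaps: "gap a m = 1" "gap a n = 1"
  shows "m = n"
proof -
  interpret dyadic_sequence a by standard (rule a)
  have "False" if mn: "m < n" "gap a m = 1" "gap a n = 1" for m n
  proof -
    have "r (Suc m) + r (Suc n) \<in> inverse_polar (polar (dyadic_set a))"
      unfolding inverse_polar_def mem_Collect_eq
    proof
      fix \<phi> assume phi: "\<phi> \<in> polar (dyadic_set a)"
      obtain s where s: "\<phi> (r (Suc m)) = circle_proj s" "\<bar>s\<bar> \<le> 1/8"
        using character_gap_1[OF a phi mn(2)] .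
      obtain t where t: "\<phi> (r (Suc n)) = circle_proj t" "\<bar>t\<bar> \<le> 1/8"
        using character_gap_1[OF a phi mn(3)] .
      have "\<phi> (r (Suc m) + r (Suc n)) = circle_proj (s + t)"
        using phi s t by (auto simp: polar_def characters_def circle_proj_add)
      moreover have "near_int (s + t)" using s t by (intro near_int_small) linarith
      ultimately show "\<phi> (r (Suc m) + r (Suc n)) \<in> circle_plus"
        by (simp add: circle_proj_mem_circle_plus)
    qed
    then show False using qc r_add_r_notin[of "Suc m" "Suc n"] mn(1)
      by (simp add: quasi_convex_def)
  qed
  then show ?thesis using gaps by (metis linorder_neqE_nat)
qed

text \<open>A gap of 2 makes \<open>r (Suc n)\<close> equal to \<open>4 * q\<close>, so the
  offending sum is \<open>5 * q\<close> and the value of a character at \<open>q\<close>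
  decides.\<close>

lemma quasi_convex_dyadic_imp_gap_Suc_neq_2:
  assumes a: "strict_mono a" and qc: "quasi_convex (dyadic_set a)" and gap: "gap a n = 1"
  shows "gap a (Suc n) \<noteq> 2"
proof
  assume gap': "gap a (Suc n) = 2"
  interpret dyadic_sequence a by standard (rule a)
  define q where "q = r (Suc (Suc n))"
  have r4: "r (Suc n) = (q + q) + (q + q)"
    using r_ratio[of "Suc n" "Suc (Suc n)"] gap' by (simp add: dist_exp_Suc q_def)
  have "r (Suc n) + q \<in> inverse_polar (polar (dyadic_set a))"
    unfolding inverse_polar_def mem_Collect_eq
  proof
    fix \<phi> assume phi: "\<phi> \<in> polar (dyadic_set a)"
    have add: "\<phi> (x + y) = \<phi> x + \<phi> y" for x y
      using phi by (auto simp: polar_def characters_def)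
    obtain s where s: "\<phi> (r (Suc n)) = circle_proj s" "\<bar>s\<bar> \<le> 1/8"
      using character_gap_1[OF a phi gap] .
    have "\<phi> q \<in> circle_plus"
      using phi by (auto simp: polar_def dyadic_set_def q_def)
    then obtain t where t: "\<phi> q = circle_proj t" "t \<in> {-1/4..1/4}"
      by (auto simp: circle_plus_def)
    have r4t: "\<phi> (r (Suc n)) = circle_proj (4 * t)"
      by (simp only: r4 add t flip: circle_proj_add) simp
    then have "4 * t - s \<in> \<int>" using s by (metis circle_proj_eq_iff)
    then obtain k where k: "4 * t - s = of_int k" by (auto elim: Ints_cases)
    have "-2 < real_of_int k" "real_of_int k < 2" using k s t by auto
    then have "k = -1 \<or> k = 0 \<or> k = 1" by linarith
    \<comment> \<open>Here \<open>5 * t - k = t + s\<close> with \<open>4 * t = k + s\<close>. If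
      \<open>k\<close> is 1 or -1, then \<open>\<bar>t\<bar> \<le> 1/4\<close> makes
      \<open>s\<close> zero or opposite in sign to \<open>k\<close>, so adding \<open>s\<close> does
      not increase \<open>\<bar>t\<bar>\<close>; if \<open>k = 0\<close>, the sum is
      \<open>5/4 * s\<close>.\<close>
    then have "\<bar>5 * t - of_int k\<bar> \<le> 1/4" using k s t(2) by (auto simp: abs_le_iff)
    then have "near_int (5 * t)" by (rule near_intI)
    moreover have "\<phi> (r (Suc n) + q) = circle_proj (5 * t)"
      by (simp add: add r4t t flip: circle_proj_add)
    ultimately show "\<phi> (r (Suc n) + q) \<in> circle_plus"
      by (simp add: circle_proj_mem_circle_plus)
  qed
  then show False using qc r_add_r_notin[of "Suc n" "Suc (Suc n)"]
    by (simp add: quasi_convex_def q_def)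
qed

theorem theorem2:
  fixes a :: "nat \<Rightarrow> int"
  assumes "strict_mono a"
  shows "quasi_convex (dyadic_set a) \<longleftrightarrow>
    (\<exists>m. \<forall>n. n \<noteq> m \<longrightarrow> gap a n > 1) \<and>
    (\<forall>n. gap a n = 1 \<longrightarrow> gap a (Suc n) > 2)"
proof -
  interpret dyadic_sequence a by standard (rule assms)
  show ?thesis
  proof (intro iffI conjI allI impI)
    assume qc: "quasi_convex (dyadic_set a)"
    note unique = quasi_convex_dyadic_imp_unique_gap_1[OF assms qc]
    \<comment> \<open>The witness is the unique index with gap 1, or any index if there is
      none.\<close>
    show "\<exists>m. \<forall>n. n \<noteq> m \<longrightarrow> gap a n > 1"
      using unique gap_ge_1 by (metis order_le_imp_less_or_eq)
    fix n assume n: "gap a n = 1"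
    then have "gap a (Suc n) \<noteq> 1" using unique[of n "Suc n"] by auto
    then show "gap a (Suc n) > 2"
      using quasi_convex_dyadic_imp_gap_Suc_neq_2[OF assms qc n] gap_ge_1[of "Suc n"] by linarith
  next
    assume "(\<exists>m. \<forall>n. n \<noteq> m \<longrightarrow> gap a n > 1) \<and> (\<forall>n. gap a n = 1 \<longrightarrow> gap a (Suc n) > 2)"
    then obtain m where m: "\<And>n. n \<noteq> m \<Longrightarrow> gap a n > 1" "gap a m = 1 \<Longrightarrow> gap a (Suc m) > 2"
      by blast
    have "x \<in> dyadic_set a" if x: "x \<in> inverse_polar (polar (dyadic_set a))" for x
    proof -
      have "bihull x" unfolding bihull_def
      proof (intro allI impI)
        fix y assume y: "\<forall>n. near_int (y * r n)"
        show "near_int (y * x)"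
          by (rule inverse_polar_polar_near_int[OF x])
            (use y near_int_small[of 0] in \<open>auto simp: dyadic_set_def\<close>)
      qed
      consider "x = 0" | "x > 0" | "- x > 0" by linarith
      then show ?thesis
      proof cases
        case 2
        then have "x \<in> range r" using bihull_pos_imp_r \<open>bihull x\<close> m by blast
        then show ?thesis by (auto simp: dyadic_set_def)
      next
        case 3
        then have "- x \<in> range r" using bihull_pos_imp_r[of "- x"] bihull_minus \<open>bihull x\<close> m by blast
        then obtain k where "x = - r k" by (metis minus_minus rangeE)
        then show ?thesis by (auto simp: dyadic_set_def)
      qed (simp add: dyadic_set_def)
    qed
    then show "quasi_convex (dyadic_set a)"
      using subset_inverse_polar_polar[of "dyadic_set a"] by (auto simp: quasi_convex_def)
  qed
qed

end
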